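(* Let $w:\mathbb N\to\mathbb N$ be a non-decreasing function with $w(n)\to\infty$ and $w(n)\le 10^{-3}\log n$ for all $n$. Then there is an absolute constant $C$ such that for every sufficiently large $n$ there exists an $n\times n$ Boolean matrix $M$ with the following properties: (i) $\mathrm{R}(M)=w(n)$; (ii) every $\lfloor n^{1/4}\rfloor\times\lfloor n^{1/4}\rfloor$ submatrix $F$ of $M$ satisfies $\mathrm{R}(F)\le C$.
   Context: A Boolean matrix has entries in $\{0,1\}$. For a Boolean matrix $M=[m_{ij}]$, in the two-party communication model Alice receives a row index $i$, Bob a column index $j$, and they must compute $m_{ij}$. A deterministic protocol is a binary tree whose internal nodes are owned by Alice or Bob and labelled by a Boolean function of that player's input, with leaves labelled $0$ or $1$; its cost is the depth of the tree. A (public-coin) randomized protocol of cost $c$ is a probability distribution over deterministic protocols of cost $c$; it computes $M$ with error at most $\epsilon$ if for every input $(i,j)$ the probability that the sampled protocol outputs something other than $m_{ij}$ is at most $\epsilon$. $\mathrm{R}(M)$ denotes the smallest cost of a randomized protocol computing $M$ with error at most $1/3$. A submatrix is obtained by selecting any subset of rows and any subset of columns. Logarithms are base 2. *)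

theory Defs
  imports
    "HOL-Probability.Probability_Mass_Function"
    "Jordan_Normal_Form.DL_Submatrix"
begin

text \<open>Boolean matrices are of type \<open>bool mat\<close> (\<open>True\<close> is the entry 1), with rows and columns
  indexed from 0. The labels of internal nodes are functions on all of \<open>nat\<close>, but a matrix only
  ever exposes their values on its own row and column indices.\<close>

datatype protocol =
    Leaf bool
  | Alice "nat \<Rightarrow> bool" protocol protocol
  | Bob "nat \<Rightarrow> bool" protocol protocol

primrec run :: "protocol \<Rightarrow> nat \<Rightarrow> nat \<Rightarrow> bool" where
  "run (Leaf b) i j = b"
| "run (Alice f p q) i j = (if f i then run q i j else run p i j)"
| "run (Bob g p q) i j = (if g j then run q i j else run p i j)"

primrec cost :: "protocol \<Rightarrow> nat" where
  "cost (Leaf b) = 0"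
| "cost (Alice f p q) = Suc (max (cost p) (cost q))"
| "cost (Bob g p q) = Suc (max (cost p) (cost q))"

text \<open>Discrete distributions lose no generality: on a fixed finite matrix, protocols of a given
  cost show only finitely many behaviours. Likewise, requiring cost exactly \<open>c\<close> instead of at most
  \<open>c\<close> is immaterial, since a leaf can be replaced by a node with two copies of that leaf.\<close>

definition randomized_protocol :: "nat \<Rightarrow> protocol pmf \<Rightarrow> bool" where
  "randomized_protocol c P \<longleftrightarrow> (\<forall>p \<in> set_pmf P. cost p = c)"

definition computes_with_error :: "real \<Rightarrow> protocol pmf \<Rightarrow> bool mat \<Rightarrow> bool" where
  "computes_with_error \<epsilon> P M \<longleftrightarrow>
     (\<forall>i < dim_row M. \<forall>j < dim_col M.
        measure_pmf.prob P {p. run p i j \<noteq> M $$ (i, j)} \<le> \<epsilon>)"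

text \<open>The set of costs below is never empty: Alice can spell out her row index, after which
  Bob announces the entry.\<close>

definition R :: "bool mat \<Rightarrow> nat" where
  "R M = (LEAST c. \<exists>P. randomized_protocol c P \<and> computes_with_error (1/3) P M)"

end

theory Submission
  imports Defs "HOL-Real_Asymp.Real_Asymp"
begin

text \<open>Call a set \<open>E\<close> of entries locally sparse if every \<open>r\<close> by \<open>r\<close> rectangle with
  \<open>r \<le> n powr (1/4)\<close> contains fewer than \<open>8r\<close> of them. A union bound over all \<open>N\<close>-element sets gives a
  locally sparse \<open>E0\<close> of size \<open>N\<close> up to \<open>n powr 1.01\<close>. In a locally sparse matrix every small
  submatrix is a disjunction of a matrix with at most 7 ones per row and one with at most 7 ones
  per column, so hashing the indices to 6 bits decides its entries at constant cost.

  On the other hand, a matrix of cost \<open>c\<close> is the entrywise majority of \<open>O(log n)\<close> deterministic protocols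
  of cost \<open>c\<close>, and these have few behaviours; hence one of the \<open>2 ^ N\<close> subsets of \<open>E0\<close> has cost above
  \<open>w(n)\<close>. Starting from the zero matrix and filling in its rows one at a time, each step raises the
  cost by at most 1 once it is positive, so the value \<open>w(n)\<close> is hit; local sparsity passes to
  subsets.\<close>

section \<open>Basic protocols and elementary bounds on \<open>R\<close>\<close>

text \<open>Nodes that ignore the input raise the cost without changing the output. They serve to
  meet the demand of \<open>randomized_protocol\<close> that the cost be exactly
  \<open>c\<close>.\<close>

primrec pad :: "nat \<Rightarrow> protocol \<Rightarrow> protocol" where
  "pad 0 p = p"
| "pad (Suc d) p = Alice (\<lambda>_. False) (pad d p) (pad d p)"

lemma run_pad [simp]: "run (pad d p) = run p"
  by (induction d) (simp_all add: fun_eq_iff)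

lemma cost_pad [simp]: "cost (pad d p) = d + cost p"
  by (induction d) simp_all

lemma ex_randomized_protocol_mono:
  assumes "randomized_protocol c P" "computes_with_error \<epsilon> P M" "c \<le> d"
  shows "\<exists>Q. randomized_protocol d Q \<and> computes_with_error \<epsilon> Q M"
proof (intro exI conjI)
  show "randomized_protocol d (map_pmf (pad (d - c)) P)"
    using assms by (auto simp: randomized_protocol_def)
  show "computes_with_error \<epsilon> (map_pmf (pad (d - c)) P) M"
    using assms by (simp add: computes_with_error_def vimage_def)
qed

text \<open>Alice transmits \<open>g i\<close> in \<open>b\<close> bits, lowest bit first, and play
  continues with \<open>K v\<close> once the value \<open>v\<close> is known to both. The bits still
  to come encode \<open>g i div 2\<close>, so the continuation reassembles the value as
  \<open>2 * v\<close> or \<open>2 * v + 1\<close>.\<close>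

primrec alice_send :: "nat \<Rightarrow> (nat \<Rightarrow> nat) \<Rightarrow> (nat \<Rightarrow> protocol) \<Rightarrow> protocol" where
  "alice_send 0 g K = K 0"
| "alice_send (Suc b) g K =
     Alice (\<lambda>i. odd (g i)) (alice_send b (\<lambda>i. g i div 2) (\<lambda>v. K (2 * v)))
       (alice_send b (\<lambda>i. g i div 2) (\<lambda>v. K (2 * v + 1)))"

primrec bob_send :: "nat \<Rightarrow> (nat \<Rightarrow> nat) \<Rightarrow> (nat \<Rightarrow> protocol) \<Rightarrow> protocol" where
  "bob_send 0 g K = K 0"
| "bob_send (Suc b) g K =
     Bob (\<lambda>j. odd (g j)) (bob_send b (\<lambda>j. g j div 2) (\<lambda>v. K (2 * v)))
       (bob_send b (\<lambda>j. g j div 2) (\<lambda>v. K (2 * v + 1)))"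

lemma run_alice_send: "g i < 2 ^ b \<Longrightarrow> run (alice_send b g K) i j = run (K (g i)) i j"
proof (induction b arbitrary: g K)
  case (Suc b)
  then have "g i div 2 < 2 ^ b" by auto
  then show ?case by (simp add: Suc.IH)
qed simp

lemma run_bob_send: "g j < 2 ^ b \<Longrightarrow> run (bob_send b g K) i j = run (K (g j)) i j"
proof (induction b arbitrary: g K)
  case (Suc b)
  then have "g j div 2 < 2 ^ b" by auto
  then show ?case by (simp add: Suc.IH)
qed simp

lemma cost_alice_send: "(\<And>v. cost (K v) = c) \<Longrightarrow> cost (alice_send b g K) = b + c"
  by (induction b arbitrary: g K) auto

lemma cost_bob_send: "(\<And>v. cost (K v) = c) \<Longrightarrow> cost (bob_send b g K) = b + c"
  by (induction b arbitrary: g K) auto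

text \<open>This gives the \<open>LEAST\<close> in \<open>R\<close> its meaning: Alice sends her row
  index and Bob answers, without any error.\<close>

lemma ex_randomized_protocol: "\<exists>c P. randomized_protocol c P \<and> computes_with_error (1/3) P M"
proof -
  obtain b where b: "dim_row M < 2 ^ b" using less_exp by blast
  define p where "p = alice_send b (\<lambda>i. i) (\<lambda>i. Bob (\<lambda>j. M $$ (i, j)) (Leaf False) (Leaf True))"
  have "run p i j = M $$ (i, j)" if "i < dim_row M" for i j
    unfolding p_def using that b by (subst run_alice_send) auto
  then have "computes_with_error (1/3) (return_pmf p) M"
    by (auto simp: computes_with_error_def)
  moreover have "randomized_protocol (cost p) (return_pmf p)"
    by (simp add: randomized_protocol_def)
  ultimately show ?thesis by blast
qed

lemma R_le:
  assumes "randomized_protocol c P" "computes_with_error (1/3) P M"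
  shows "R M \<le> c"
  unfolding R_def by (rule Least_le) (use assms in blast)

lemma R_attained:
  assumes "R M \<le> c"
  shows "\<exists>P. randomized_protocol c P \<and> computes_with_error (1/3) P M"
proof -
  have "\<exists>P. randomized_protocol (R M) P \<and> computes_with_error (1/3) P M"
    unfolding R_def by (rule LeastI_ex) (rule ex_randomized_protocol)
  then show ?thesis using ex_randomized_protocol_mono assms by blast
qed

lemma R_zero:
  assumes "\<And>i j. i < dim_row M \<Longrightarrow> j < dim_col M \<Longrightarrow> \<not> M $$ (i, j)"
  shows "R M = 0"
proof -
  have "R M \<le> 0"
    by (rule R_le[of _ "return_pmf (Leaf False)"])
       (use assms in \<open>auto simp: randomized_protocol_def computes_with_error_def\<close>)
  then show ?thesis by simp
qed

text \<open>Alice first says whether her row is \<open>r\<close>. If it is, Bob can announce the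
  entry himself; otherwise the protocol for \<open>M\<close> runs. The \<open>max\<close> with 1
  leaves room for Bob's bit.\<close>

lemma R_change_row:
  assumes dim: "dim_row M' = dim_row M" "dim_col M' = dim_col M"
    and eq: "\<And>i j. i < dim_row M \<Longrightarrow> j < dim_col M \<Longrightarrow> i \<noteq> r \<Longrightarrow> M' $$ (i, j) = M $$ (i, j)"
  shows "R M' \<le> Suc (max (R M) 1)"
proof -
  define c where "c = max (R M) 1"
  obtain P where P: "randomized_protocol c P" "computes_with_error (1/3) P M"
    using R_attained[of M c] by (auto simp: c_def)
  define q where "q = pad (c - 1) (Bob (\<lambda>j. M' $$ (r, j)) (Leaf False) (Leaf True))"
  define Q where "Q = map_pmf (\<lambda>p. Alice (\<lambda>i. i = r) p q) P"
  have "cost q = c" by (simp add: q_def c_def)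
  then have "randomized_protocol (Suc c) Q"
    using P by (auto simp: randomized_protocol_def Q_def)
  moreover have "computes_with_error (1/3) Q M'"
    unfolding computes_with_error_def
  proof (intro allI impI)
    fix i j assume ij: "i < dim_row M'" "j < dim_col M'"
    show "measure_pmf.prob Q {p. run p i j \<noteq> M' $$ (i, j)} \<le> 1/3"
    proof (cases "i = r")
      case True
      then show ?thesis by (simp add: Q_def vimage_def q_def)
    next
      case False
      then show ?thesis using P(2) ij dim
        by (simp add: Q_def vimage_def computes_with_error_def eq)
    qed
  qed
  ultimately show ?thesis unfolding c_def by (rule R_le)
qed

section \<open>Random hashing for matrices that split into light rows and light columns\<close>

text \<open>A colliding \<open>h\<close> is determined by its values away from \<open>x\<close>,
  since \<open>h x\<close> can be read off at \<open>y\<close>. So at most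
  \<open>m ^ (n - 1)\<close> of the \<open>m ^ n\<close> functions collide.\<close>

lemma prob_hash_collision:
  fixes m n :: nat
  assumes "x < n" "y < n" "x \<noteq> y" "m > 0"
  shows "measure_pmf.prob (pmf_of_set (PiE {..<n} (\<lambda>_. {..<m}))) {h. h x = h y} \<le> 1 / real m"
proof -
  let ?H = "PiE {..<n} (\<lambda>_. {..<m::nat})"
  have fin: "finite ?H" by (intro finite_PiE) auto
  have ne: "?H \<noteq> {}" using assms by (auto simp: PiE_eq_empty_iff)
  have inj: "inj_on (\<lambda>h. restrict h ({..<n} - {x})) (?H \<inter> {h. h x = h y})"
  proof (rule inj_onI)
    fix g h assume g: "g \<in> ?H \<inter> {h. h x = h y}" and h: "h \<in> ?H \<inter> {h. h x = h y}"
      and eq: "restrict g ({..<n} - {x}) = restrict h ({..<n} - {x})"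
    have *: "g z = h z" if "z < n" "z \<noteq> x" for z
      using fun_cong[OF eq, of z] that by simp
    then have "g x = h x" using g h assms by auto
    with * have "\<And>z. z \<in> {..<n} \<Longrightarrow> g z = h z" by (metis lessThan_iff)
    then show "g = h" using g h by (intro PiE_ext[of g "{..<n}" "\<lambda>_. {..<m}" h]) auto
  qed
  have "(\<lambda>h. restrict h ({..<n} - {x})) ` (?H \<inter> {h. h x = h y}) \<subseteq> PiE ({..<n} - {x}) (\<lambda>_. {..<m})"
    by (intro image_subsetI) (auto simp: PiE_def Pi_def)
  then have "card (?H \<inter> {h. h x = h y}) \<le> card (PiE ({..<n} - {x}) (\<lambda>_. {..<m}))"
    by (rule card_inj_on_le[OF inj]) (simp add: finite_PiE)
  also have "\<dots> = m ^ (n - 1)"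
    using assms by (subst card_PiE) auto
  finally have le: "card (?H \<inter> {h. h x = h y}) \<le> m ^ (n - 1)" .
  have c: "card ?H = m ^ n" by (subst card_PiE) auto
  have "measure_pmf.prob (pmf_of_set ?H) {h. h x = h y} = card (?H \<inter> {h. h x = h y}) / m ^ n"
    using fin ne c by (simp add: measure_pmf_of_set)
  also have "\<dots> \<le> real (m ^ (n - 1)) / real (m ^ n)"
    using le by (intro divide_right_mono) (auto simp del: of_nat_power)
  also have "\<dots> = 1 / real m"
    using assms by (cases n) auto
  finally show ?thesis .
qed

lemma prob_hash_collision_set:
  fixes m n :: nat
  assumes "x < n" "A \<subseteq> {..<n}" "x \<notin> A" "m > 0"
  shows "measure_pmf.prob (pmf_of_set (PiE {..<n} (\<lambda>_. {..<m}))) {h. h x \<in> h ` A} \<le> card A / real m"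
proof -
  let ?H = "pmf_of_set (PiE {..<n} (\<lambda>_. {..<m::nat}))"
  have fin: "finite A" using assms finite_subset by blast
  have "measure_pmf.prob ?H {h. h x \<in> h ` A} = measure_pmf.prob ?H (\<Union>y\<in>A. {h. h x = h y})"
    by (rule arg_cong[where f = "measure_pmf.prob ?H"]) auto
  also have "\<dots> \<le> (\<Sum>y\<in>A. measure_pmf.prob ?H {h. h x = h y})"
    using fin by (intro measure_pmf.finite_measure_subadditive_finite) auto
  also have "\<dots> \<le> (\<Sum>y\<in>A. 1 / real m)"
    using assms by (intro sum_mono prob_hash_collision) auto
  finally show ?thesis by simp
qed

text \<open>Bob sends the hash of his label \<open>y\<close>, and Alice says whether it occurs among the hashes of
  \<open>a x\<close>, where \<open>x\<close> is her label; then the roles are exchanged with \<open>b\<close> in place of \<open>a\<close>. Only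
  a collision can cause an error, and only on a zero entry.\<close>

definition hash_protocol where
  "hash_protocol \<rho> \<sigma> a b h =
     (let K = (\<lambda>x. alice_send 6 (\<lambda>i. h (\<rho> i))
         (\<lambda>u. Bob (\<lambda>j. x \<or> u \<in> h ` b (\<sigma> j)) (Leaf False) (Leaf True)))
      in bob_send 6 (\<lambda>j. h (\<sigma> j)) (\<lambda>v. Alice (\<lambda>i. v \<in> h ` a (\<rho> i)) (K False) (K True)))"

lemma cost_hash_protocol: "cost (hash_protocol \<rho> \<sigma> a b h) = 14"
proof -
  have *: "cost (alice_send 6 g (\<lambda>u. Bob (f u) (Leaf False) (Leaf True))) = 6 + 1" for g f
    by (rule cost_alice_send) simp
  have "cost (hash_protocol \<rho> \<sigma> a b h) = 6 + 8"
    unfolding hash_protocol_def Let_def by (rule cost_bob_send) (simp add: *)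
  then show ?thesis by simp
qed

lemma run_hash_protocol:
  assumes "h (\<rho> i) < 64" "h (\<sigma> j) < 64"
  shows "run (hash_protocol \<rho> \<sigma> a b h) i j \<longleftrightarrow> h (\<sigma> j) \<in> h ` a (\<rho> i) \<or> h (\<rho> i) \<in> h ` b (\<sigma> j)"
  unfolding hash_protocol_def Let_def using assms
  by (simp add: run_alice_send run_bob_send)

text \<open>On a zero entry each of the two membership tests fires wrongly with probability at most
  7/64, and 14/64 < 1/3. The cost 14 consists of two 6-bit hashes and two one-bit answers. The maps
  \<open>\<rho>\<close> and \<open>\<sigma>\<close> are meant to translate indices of a submatrix
  into indices of the whole matrix.\<close>

lemma R_le_14:
  fixes \<rho> \<sigma> :: "nat \<Rightarrow> nat"
  assumes lt: "\<And>i. i < dim_row F \<Longrightarrow> \<rho> i < n" "\<And>j. j < dim_col F \<Longrightarrow> \<sigma> j < n"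
    and a: "\<And>x. x < n \<Longrightarrow> a x \<subseteq> {..<n} \<and> card (a x) \<le> 7"
    and b: "\<And>y. y < n \<Longrightarrow> b y \<subseteq> {..<n} \<and> card (b y) \<le> 7"
    and F: "\<And>i j. i < dim_row F \<Longrightarrow> j < dim_col F \<Longrightarrow>
       F $$ (i, j) \<longleftrightarrow> \<sigma> j \<in> a (\<rho> i) \<or> \<rho> i \<in> b (\<sigma> j)"
  shows "R F \<le> 14"
proof -
  let ?H = "PiE {..<n} (\<lambda>_. {..<64::nat})"
  define P where "P = map_pmf (hash_protocol \<rho> \<sigma> a b) (pmf_of_set ?H)"
  have fin: "finite ?H" by (intro finite_PiE) auto
  have ne: "?H \<noteq> {}" by (simp add: PiE_eq_empty_iff lessThan_empty_iff)
  have set: "set_pmf (pmf_of_set ?H) = ?H" using fin ne by simp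
  have "randomized_protocol 14 P"
    by (auto simp: randomized_protocol_def P_def cost_hash_protocol)
  moreover have "computes_with_error (1/3) P F"
    unfolding computes_with_error_def
  proof (intro allI impI)
    fix i j assume i: "i < dim_row F" and j: "j < dim_col F"
    let ?E = "{h. run (hash_protocol \<rho> \<sigma> a b h) i j \<noteq> F $$ (i, j)}"
    have run: "run (hash_protocol \<rho> \<sigma> a b h) i j \<longleftrightarrow>
        h (\<sigma> j) \<in> h ` a (\<rho> i) \<or> h (\<rho> i) \<in> h ` b (\<sigma> j)" if "h \<in> ?H" for h
      using lt(1)[OF i] lt(2)[OF j] that by (intro run_hash_protocol) (auto simp: PiE_iff)
    have "measure_pmf.prob P {p. run p i j \<noteq> F $$ (i, j)} = measure_pmf.prob (pmf_of_set ?H) ?E"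
      by (simp add: P_def vimage_def)
    also have "\<dots> \<le> 1/3"
    proof (cases "F $$ (i, j)")
      case True
      then have "h \<notin> ?E" if "h \<in> ?H" for h
        using run[OF that] F[OF i j] by auto
      then have "measure_pmf.prob (pmf_of_set ?H) ?E = 0"
        unfolding measure_pmf_zero_iff set by blast
      then show ?thesis by simp
    next
      case False
      then have nin: "\<sigma> j \<notin> a (\<rho> i)" "\<rho> i \<notin> b (\<sigma> j)" using F[OF i j] by auto
      let ?A = "{h. h (\<sigma> j) \<in> h ` a (\<rho> i)}" and ?B = "{h. h (\<rho> i) \<in> h ` b (\<sigma> j)}"
      \<comment> \<open>Only functions in \<open>?H\<close> are known to have values that fit into 6
        bits, so the event is first cut down to the support.\<close>
      have "measure_pmf.prob (pmf_of_set ?H) ?E = measure_pmf.prob (pmf_of_set ?H) (?E \<inter> ?H)"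
        using measure_Int_set_pmf[of "pmf_of_set ?H" ?E] set by simp
      also have "\<dots> \<le> measure_pmf.prob (pmf_of_set ?H) (?A \<union> ?B)"
        by (rule measure_pmf.finite_measure_mono) (use run False in auto)
      also have "\<dots> \<le> measure_pmf.prob (pmf_of_set ?H) ?A + measure_pmf.prob (pmf_of_set ?H) ?B"
        by (rule measure_subadditive) (auto simp: measure_pmf.emeasure_eq_measure)
      also have "\<dots> \<le> card (a (\<rho> i)) / real 64 + card (b (\<sigma> j)) / real 64"
        using a[OF lt(1)[OF i]] b[OF lt(2)[OF j]] nin lt(1)[OF i] lt(2)[OF j]
        by (intro add_mono prob_hash_collision_set) auto
      also have "\<dots> \<le> 1/3"
        using a[OF lt(1)[OF i]] b[OF lt(2)[OF j]] by simp
      finally show ?thesis .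
    qed
    finally show "measure_pmf.prob P {p. run p i j \<noteq> F $$ (i, j)} \<le> 1/3" .
  qed
  ultimately show ?thesis by (rule R_le)
qed

section \<open>Derandomization by majority vote\<close>

text \<open>Averaging: under \<open>P\<close> the expected factor on each weight is at most
  \<open>1 + \<epsilon>\<close>, so not every protocol in the support can exceed this bound in
  total.\<close>

lemma ex_protocol_weighted_error:
  fixes W :: "'z \<Rightarrow> real" and P :: "'b pmf"
  assumes Z: "finite Z" "\<And>z. z \<in> Z \<Longrightarrow> W z \<ge> 0"
    and err: "\<And>z. z \<in> Z \<Longrightarrow> measure_pmf.prob P {p. err p z} \<le> \<epsilon>"
  shows "\<exists>p\<in>set_pmf P. (\<Sum>z\<in>Z. W z * (if err p z then 2 else 1)) \<le> (1 + \<epsilon>) * (\<Sum>z\<in>Z. W z)"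
proof (rule ccontr)
  \<comment> \<open>Written as 1 plus an indicator, the factor has expectation 1 plus the error
    probability.\<close>
  define g where "g p = (\<Sum>z\<in>Z. W z * (1 + indicator {p. err p z} p))" for p
  have g: "g p = (\<Sum>z\<in>Z. W z * (if err p z then 2 else 1))" for p
    unfolding g_def by (rule sum.cong) auto
  assume "\<not> ?thesis"
  then have gt: "(1 + \<epsilon>) * (\<Sum>z\<in>Z. W z) < g p" if "p \<in> set_pmf P" for p
    using that unfolding g by (auto simp: not_le)
  have ind: "integrable (measure_pmf P) (indicator {p. err p z} :: 'b \<Rightarrow> real)" for z
    by (rule measure_pmf.integrable_const_bound[where B = 1]) auto
  have int: "integrable (measure_pmf P) (\<lambda>p. W z * (1 + indicator {p. err p z} p))" for z
    by (intro integrable_mult_right Bochner_Integration.integrable_add ind) auto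
  have exp: "measure_pmf.expectation P (\<lambda>p. W z * (1 + indicator {p. err p z} p)) =
      W z * (1 + measure_pmf.prob P {p. err p z})" for z
    by (simp add: Bochner_Integration.integral_add ind)
  have "(1 + \<epsilon>) * (\<Sum>z\<in>Z. W z) < measure_pmf.expectation P g"
  proof (rule measure_pmf.expectation_greater)
    show "integrable (measure_pmf P) g"
      unfolding g_def by (intro Bochner_Integration.integrable_sum int)
    show "AE p in measure_pmf P. (1 + \<epsilon>) * (\<Sum>z\<in>Z. W z) < g p"
      using gt by (simp add: AE_measure_pmf_iff)
  qed
  also have "measure_pmf.expectation P g = (\<Sum>z\<in>Z. W z * (1 + measure_pmf.prob P {p. err p z}))"
    unfolding g_def by (subst Bochner_Integration.integral_sum[OF int]) (simp only: exp)
  also have "\<dots> \<le> (\<Sum>z\<in>Z. W z * (1 + \<epsilon>))"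
    by (intro sum_mono mult_left_mono) (use Z err in auto)
  also have "\<dots> = (1 + \<epsilon>) * (\<Sum>z\<in>Z. W z)"
    by (subst mult.commute) (simp only: sum_distrib_right)
  finally show False by simp
qed

text \<open>Multiplicative weights: each input starts with weight 1, and a further protocol that errs
  on an input doubles the weight of that input.\<close>

lemma ex_protocol_list:
  assumes Z: "finite Z"
    and err: "\<And>z. z \<in> Z \<Longrightarrow> measure_pmf.prob P {p. err p z} \<le> \<epsilon>" and "\<epsilon> \<ge> 0"
  shows "\<exists>ps. set ps \<subseteq> set_pmf P \<and> length ps = t \<and>
     (\<Sum>z\<in>Z. 2 ^ length (filter (\<lambda>p. err p z) ps)) \<le> (1 + \<epsilon>) ^ t * real (card Z)"
proof (induction t)
  case 0
  show ?case by simp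
next
  case (Suc t)
  then obtain ps where ps: "set ps \<subseteq> set_pmf P" "length ps = t"
    "(\<Sum>z\<in>Z. 2 ^ length (filter (\<lambda>p. err p z) ps)) \<le> (1 + \<epsilon>) ^ t * real (card Z)"
    by blast
  let ?W = "\<lambda>z. 2 ^ length (filter (\<lambda>p. err p z) ps) :: real"
  obtain p where p: "p \<in> set_pmf P"
    "(\<Sum>z\<in>Z. ?W z * (if err p z then 2 else 1)) \<le> (1 + \<epsilon>) * (\<Sum>z\<in>Z. ?W z)"
    using ex_protocol_weighted_error[of Z ?W P err \<epsilon>] Z err by auto
  have "(\<Sum>z\<in>Z. 2 ^ length (filter (\<lambda>p. err p z) (p # ps))) =
      (\<Sum>z\<in>Z. ?W z * (if err p z then 2 else 1))"
    by (rule sum.cong) auto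
  also note p(2)
  also have "(1 + \<epsilon>) * (\<Sum>z\<in>Z. ?W z) \<le> (1 + \<epsilon>) * ((1 + \<epsilon>) ^ t * real (card Z))"
    using ps(3) \<open>\<epsilon> \<ge> 0\<close> by (intro mult_left_mono) auto
  finally show ?case using ps p(1)
    by (intro exI[of _ "p # ps"]) (auto simp: mult.assoc)
qed

text \<open>An input on which \<open>s\<close> or more protocols err has weight at least
  \<open>2 ^ s\<close> by itself. After \<open>2 * s\<close> rounds the total weight is at most
  \<open>(16/9) ^ s * card Z\<close>, which is less than \<open>2 ^ s\<close> because 16/9 * 9/8 =
  2.\<close>

lemma ex_majority:
  assumes Z: "finite Z" and err: "\<And>z. z \<in> Z \<Longrightarrow> measure_pmf.prob P {p. err p z} \<le> 1/3"
    and large: "real (card Z) < (9/8) ^ s"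
  shows "\<exists>ps. set ps \<subseteq> set_pmf P \<and> length ps = 2 * s \<and>
     (\<forall>z\<in>Z. length (filter (\<lambda>p. err p z) ps) < s)"
proof -
  obtain ps where ps: "set ps \<subseteq> set_pmf P" "length ps = 2 * s"
    "(\<Sum>z\<in>Z. 2 ^ length (filter (\<lambda>p. err p z) ps)) \<le> (1 + 1/3) ^ (2 * s) * real (card Z)"
    using ex_protocol_list[of Z P err "1/3" "2 * s"] Z err by auto
  have "length (filter (\<lambda>p. err p z) ps) < s" if z: "z \<in> Z" for z
  proof (rule ccontr)
    assume "\<not> ?thesis"
    then have "(2::real) ^ s \<le> 2 ^ length (filter (\<lambda>p. err p z) ps)"
      by (intro power_increasing) auto
    also have "\<dots> \<le> (\<Sum>z\<in>Z. 2 ^ length (filter (\<lambda>p. err p z) ps))"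
      using Z z by (intro member_le_sum) auto
    also note ps(3)
    also have "(1 + 1/3 :: real) ^ (2 * s) * real (card Z) < (16/9) ^ s * (9/8) ^ s"
      using large by (simp add: power_mult power2_eq_square)
    also have "\<dots> = 2 ^ s" by (simp flip: power_mult_distrib)
    finally show False by simp
  qed
  with ps show ?thesis by blast
qed

section \<open>Counting the matrices of low cost\<close>

text \<open>Node labels are functions on all of \<open>nat\<close>, so protocols of bounded cost are
  infinitely many; what can be counted is their behaviour on the \<open>n\<close> by
  \<open>n\<close> grid.\<close>

definition ones_of :: "nat \<Rightarrow> protocol \<Rightarrow> (nat \<times> nat) set" where
  "ones_of n p = {(i, j). i < n \<and> j < n \<and> run p i j}"

definition ones_le :: "nat \<Rightarrow> nat \<Rightarrow> (nat \<times> nat) set set" where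
  "ones_le n c = ones_of n ` {p. cost p \<le> c}"

text \<open>A behaviour is coded by the owner of the root (\<open>True\<close> for Alice), the
  indices that the root sends to its second child, and the behaviours of the two children.\<close>

lemma ones_le_Suc:
  "ones_le n (Suc c) \<subseteq>
     (\<lambda>(s, A, X, Y). {(i, j). if (if s then i else j) \<in> A then (i, j) \<in> Y else (i, j) \<in> X}) `
       (UNIV \<times> Pow {..<n} \<times> ones_le n c \<times> ones_le n c)" (is "_ \<subseteq> ?f ` ?D")
proof
  fix E assume "E \<in> ones_le n (Suc c)"
  then obtain p where p: "E = ones_of n p" "cost p \<le> Suc c"
    by (auto simp: ones_le_def)
  show "E \<in> ?f ` ?D"
  proof (cases p)
    case (Leaf b)
    \<comment> \<open>A leaf is coded as a node with two equal children.\<close>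
    show ?thesis
      by (rule image_eqI[where x = "(True, {}, E, E)"])
         (auto simp: p Leaf ones_le_def intro!: imageI)
  next
    case (Alice f q r)
    show ?thesis
      by (rule image_eqI[where x = "(True, {i. i < n \<and> f i}, ones_of n q, ones_of n r)"])
         (use p Alice in \<open>auto simp: ones_of_def ones_le_def\<close>)
  next
    case (Bob f q r)
    show ?thesis
      by (rule image_eqI[where x = "(False, {i. i < n \<and> f i}, ones_of n q, ones_of n r)"])
         (use p Bob in \<open>auto simp: ones_of_def ones_le_def\<close>)
  qed
qed

text \<open>If \<open>x\<close> behaviours are possible at cost \<open>c\<close>, at most
  \<open>2 ^ (n + 1) * x ^ 2\<close> are possible at cost \<open>c + 1\<close>. The extra factor
  \<open>2 ^ (n + 1)\<close> on the left turns this recursion into plain squaring, starting from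
  \<open>2 ^ (n + 2)\<close>.\<close>

lemma card_ones_le: "finite (ones_le n c) \<and> card (ones_le n c) * 2 ^ (n + 1) \<le> 2 ^ ((n + 2) * 2 ^ c)"
proof (induction c)
  case 0
  have "p = Leaf True \<or> p = Leaf False" if "cost p = 0" for p
    using that by (cases p) auto
  then have sub: "ones_le n 0 \<subseteq> {ones_of n (Leaf True), ones_of n (Leaf False)}"
    by (auto simp: ones_le_def)
  have "card (ones_le n 0) \<le> card {ones_of n (Leaf True), ones_of n (Leaf False)}"
    by (intro card_mono sub) simp
  also have "\<dots> \<le> 2" by (simp add: card_insert_if)
  finally show ?case using finite_subset[OF sub] by simp
next
  case (Suc c)
  let ?B = "ones_le n c"
  have fin: "finite ((UNIV :: bool set) \<times> Pow {..<n} \<times> ?B \<times> ?B)" using Suc by simp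
  have fin': "finite (ones_le n (Suc c))"
    by (rule finite_subset[OF ones_le_Suc]) (use fin in blast)
  have "card (ones_le n (Suc c)) \<le> card ((UNIV :: bool set) \<times> Pow {..<n} \<times> ?B \<times> ?B)"
    by (rule surj_card_le[OF fin ones_le_Suc])
  then have "card (ones_le n (Suc c)) \<le> 2 ^ (n + 1) * (card ?B * card ?B)"
    by (simp add: card_cartesian_product card_Pow)
  then have "card (ones_le n (Suc c)) * 2 ^ (n + 1) \<le> 2 ^ (n + 1) * (card ?B * card ?B) * 2 ^ (n + 1)"
    by (rule mult_right_mono) simp
  also have "\<dots> = (card ?B * 2 ^ (n + 1)) ^ 2" by (simp add: power2_eq_square)
  also have "\<dots> \<le> (2 ^ ((n + 2) * 2 ^ c)) ^ 2"
    using Suc by (intro power_mono) auto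
  also have "\<dots> = 2 ^ ((n + 2) * 2 ^ Suc c)"
    by (simp add: mult.commute mult.left_commute flip: power_mult)
  finally show ?case using fin' by blast
qed

definition mat_of_ones :: "nat \<Rightarrow> (nat \<times> nat) set \<Rightarrow> bool mat" where
  "mat_of_ones n E = mat n n (\<lambda>ij. ij \<in> E)"

text \<open>By \<open>ex_majority\<close> such an \<open>E\<close> is the majority of
  \<open>2 * s\<close> behaviours of cost at most \<open>c\<close>, so there are no more such sets
  than lists of \<open>2 * s\<close> behaviours.\<close>

lemma card_low_cost:
  assumes large: "real (n * n) < (9/8) ^ s"
  shows "card {E \<in> Pow ({..<n} \<times> {..<n}). R (mat_of_ones n E) \<le> c} \<le> 2 ^ ((n + 2) * 2 ^ c * (2 * s))"
proof -
  let ?L = "{Xs. set Xs \<subseteq> ones_le n c \<and> length Xs = 2 * s}"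
  \<comment> \<open>No ties arise: fewer than \<open>s\<close> of the \<open>2 * s\<close> protocols
    err, so an entry in \<open>E\<close> gets more than \<open>s\<close> votes and any other entry
    fewer than \<open>s\<close>.\<close>
  define maj where "maj Xs = {z. s < length (filter (\<lambda>X. z \<in> X) Xs)}" for Xs :: "(nat \<times> nat) set list"
  have fin: "finite (ones_le n c)" using card_ones_le by blast
  have "{E \<in> Pow ({..<n} \<times> {..<n}). R (mat_of_ones n E) \<le> c} \<subseteq> (\<lambda>Xs. maj Xs \<inter> {..<n} \<times> {..<n}) ` ?L"
  proof safe
    fix E assume E: "E \<subseteq> {..<n} \<times> {..<n}" and "R (mat_of_ones n E) \<le> c"
    then obtain P where P: "randomized_protocol c P" "computes_with_error (1/3) P (mat_of_ones n E)"
      using R_attained by blast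
    define err where "err p z \<longleftrightarrow> (z \<in> ones_of n p) \<noteq> (z \<in> E)" for p z
    have "measure_pmf.prob P {p. err p z} \<le> 1/3" if "z \<in> {..<n} \<times> {..<n}" for z
      using P(2) that
      by (auto simp: computes_with_error_def mat_of_ones_def err_def ones_of_def)
    then obtain ps where ps: "set ps \<subseteq> set_pmf P" "length ps = 2 * s"
      "\<And>z. z \<in> {..<n} \<times> {..<n} \<Longrightarrow> length (filter (\<lambda>p. err p z) ps) < s"
      using ex_majority[of "{..<n} \<times> {..<n}" P err s] large by (auto simp: card_cartesian_product)
    let ?Xs = "map (ones_of n) ps"
    have "z \<in> E \<longleftrightarrow> z \<in> maj ?Xs" if z: "z \<in> {..<n} \<times> {..<n}" for z
    proof -
      have sum: "length (filter (\<lambda>p. z \<in> ones_of n p) ps) + length (filter (\<lambda>p. z \<notin> ones_of n p) ps) = 2 * s"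
        using sum_length_filter_compl[of "\<lambda>p. z \<in> ones_of n p" ps] ps(2) by simp
      have "z \<in> maj ?Xs \<longleftrightarrow> s < length (filter (\<lambda>p. z \<in> ones_of n p) ps)"
        by (simp add: maj_def filter_map o_def)
      then show ?thesis using ps(3)[OF z] sum
        by (cases "z \<in> E") (auto simp: err_def)
    qed
    then have "E = maj ?Xs \<inter> {..<n} \<times> {..<n}" using E by blast
    moreover have "?Xs \<in> ?L"
      using ps P(1) by (auto simp: ones_le_def randomized_protocol_def)
    ultimately show "E \<in> (\<lambda>Xs. maj Xs \<inter> {..<n} \<times> {..<n}) ` ?L" by (rule image_eqI)
  qed
  then have "card {E \<in> Pow ({..<n} \<times> {..<n}). R (mat_of_ones n E) \<le> c} \<le> card ?L"
    by (rule surj_card_le[OF finite_lists_length_eq[OF fin]])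
  also have "\<dots> = card (ones_le n c) ^ (2 * s)"
    by (rule card_lists_length_eq[OF fin])
  also have "\<dots> \<le> (2 ^ ((n + 2) * 2 ^ c)) ^ (2 * s)"
  proof (rule power_mono)
    have "card (ones_le n c) * 1 \<le> card (ones_le n c) * 2 ^ (n + 1)" by (rule mult_left_mono) auto
    then show "card (ones_le n c) \<le> 2 ^ ((n + 2) * 2 ^ c)"
      using card_ones_le[of n c] by linarith
  qed simp
  finally show ?thesis by (simp only: power_mult)
qed

section \<open>Existence of locally sparse sets\<close>

text \<open>Only squares are tested, which keeps the union bound to a single size parameter; other
  rectangles are enlarged to squares in \<open>ex_light_row\<close>.\<close>

definition locally_sparse :: "nat \<Rightarrow> nat \<Rightarrow> (nat \<times> nat) set \<Rightarrow> bool" where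
  "locally_sparse n k E \<longleftrightarrow> (\<forall>S T. S \<subseteq> {..<n} \<longrightarrow> T \<subseteq> {..<n} \<longrightarrow> card S = card T \<longrightarrow>
     1 \<le> card S \<longrightarrow> card S \<le> k \<longrightarrow> card (E \<inter> S \<times> T) < 8 * card S)"

lemma locally_sparseD:
  assumes "locally_sparse n k E" "S \<subseteq> {..<n}" "T \<subseteq> {..<n}" "card S = card T" "1 \<le> card S" "card S \<le> k"
  shows "card (E \<inter> S \<times> T) < 8 * card S"
  using assms unfolding locally_sparse_def by simp

lemma locally_sparse_subset:
  assumes "locally_sparse n k E" "F \<subseteq> E"
  shows "locally_sparse n k F"
  unfolding locally_sparse_def
proof (intro allI impI)
  fix S T assume *: "S \<subseteq> {..<n}" "T \<subseteq> {..<n}" "card S = card T" "1 \<le> card S" "card S \<le> k"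
  then have "finite S" "finite T" using finite_subset by blast+
  then have "card (F \<inter> S \<times> T) \<le> card (E \<inter> S \<times> T)"
    using assms(2) by (intro card_mono) auto
  also have "\<dots> < 8 * card S" using assms(1) * by (rule locally_sparseD)
  finally show "card (F \<inter> S \<times> T) < 8 * card S" .
qed

text \<open>The quotient of the two binomials is a product of \<open>a\<close> factors
  \<open>(N - i) / (M - i)\<close>, each at most \<open>N / M\<close>.\<close>

lemma choose_ratio_le:
  assumes "a \<le> N" "N \<le> M"
  shows "((M - a) choose (N - a)) * M ^ a \<le> (M choose N) * N ^ a"
  using assms(1)
proof (induction a)
  case (Suc a)
  let ?x = "(M - Suc a) choose (N - Suc a)" and ?y = "(M - a) choose (N - a)"
  have "(M - a) * ?x = ?y * (N - a)"
    using Suc.prems assms(2) Suc_times_binomial_eq[of "M - Suc a" "N - Suc a"]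
    by (simp add: Suc_diff_Suc)
  then have "(M - a) * (?x * M) = ?y * ((N - a) * M)" by (simp add: algebra_simps)
  also have "(N - a) * M \<le> N * (M - a)"
    unfolding diff_mult_distrib diff_mult_distrib2
    by (rule diff_le_mono2) (use assms(2) in simp)
  then have "?y * ((N - a) * M) \<le> ?y * (N * (M - a))" by (rule mult_left_mono) simp
  finally have "(M - a) * (?x * M) \<le> (M - a) * (?y * N)" by (simp add: algebra_simps)
  then have step: "?x * M \<le> ?y * N" using Suc.prems assms(2) by simp
  have "?x * M ^ Suc a = (?x * M) * M ^ a" by simp
  also have "\<dots> \<le> (?y * N) * M ^ a" using step by (rule mult_right_mono) simp
  also have "\<dots> = (?y * M ^ a) * N" by simp
  also have "\<dots> \<le> ((M choose N) * N ^ a) * N" using Suc by (intro mult_right_mono) auto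
  finally show ?case by (simp add: mult_ac)
qed simp

text \<open>A superset \<open>E\<close> of \<open>A\<close> is determined by \<open>E - A\<close>.
  In probabilistic terms, a random \<open>N\<close>-subset of \<open>U\<close> contains
  \<open>A\<close> with at most the probability that independent choices of density
  \<open>N / card U\<close> would give.\<close>

lemma card_supersets_le:
  assumes "finite U" "A \<subseteq> U" "N \<le> card U"
  shows "real (card {E. E \<subseteq> U \<and> card E = N \<and> A \<subseteq> E}) \<le>
    real (card U choose N) * (real N / real (card U)) ^ card A"
proof (cases "card A \<le> N")
  case False
  have "card A \<le> card E" if "E \<subseteq> U" "A \<subseteq> E" for E
    using that assms(1) by (intro card_mono) (auto intro: finite_subset)
  then have none: "{E. E \<subseteq> U \<and> card E = N \<and> A \<subseteq> E} = {}" using False by blast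
  show ?thesis unfolding none by simp
next
  case True
  have finA: "finite A" using assms finite_subset by blast
  let ?C = "{B. B \<subseteq> U - A \<and> card B = N - card A}"
  have "{E. E \<subseteq> U \<and> card E = N \<and> A \<subseteq> E} \<subseteq> (\<lambda>B. B \<union> A) ` ?C"
  proof
    fix E assume "E \<in> {E. E \<subseteq> U \<and> card E = N \<and> A \<subseteq> E}"
    then show "E \<in> (\<lambda>B. B \<union> A) ` ?C"
      using finA by (intro image_eqI[where x = "E - A"]) (auto simp: card_Diff_subset)
  qed
  then have "card {E. E \<subseteq> U \<and> card E = N \<and> A \<subseteq> E} \<le> card ?C"
    by (rule surj_card_le[rotated]) (use assms(1) in auto)
  also have "\<dots> = (card U - card A) choose (N - card A)"
    using assms finA by (simp add: n_subsets card_Diff_subset)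
  finally have le: "card {E. E \<subseteq> U \<and> card E = N \<and> A \<subseteq> E} \<le> \<dots>" .
  have "card {E. E \<subseteq> U \<and> card E = N \<and> A \<subseteq> E} * card U ^ card A
      \<le> ((card U - card A) choose (N - card A)) * card U ^ card A"
    using le by (rule mult_right_mono) simp
  also have "\<dots> \<le> (card U choose N) * N ^ card A"
    using True assms(3) by (intro choose_ratio_le) auto
  finally have "real (card {E. E \<subseteq> U \<and> card E = N \<and> A \<subseteq> E}) * real (card U) ^ card A
      \<le> real (card U choose N) * real N ^ card A"
    by (simp flip: of_nat_mult of_nat_power)
  \<comment> \<open>For empty \<open>U\<close> also \<open>A\<close> is empty, and the power is
    \<open>0 ^ 0 = 1\<close>.\<close>
  moreover have "real (card U) ^ card A > 0"
    using assms(1,2) by (cases "U = {}") (simp_all add: card_gt_0_iff)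
  ultimately show ?thesis
    by (simp only: power_divide times_divide_eq_right pos_le_divide_eq)
qed

lemma card_UN_le_mult:
  assumes "finite I" "\<And>i. i \<in> I \<Longrightarrow> real (card (f i)) \<le> c"
  shows "real (card (\<Union>i\<in>I. f i)) \<le> real (card I) * c"
proof -
  have "real (card (\<Union>i\<in>I. f i)) \<le> (\<Sum>i\<in>I. real (card (f i)))"
    using card_UN_le[OF assms(1), of f] by (simp flip: of_nat_sum)
  also have "\<dots> \<le> real (card I) * c" using assms(2) by (rule sum_bounded_above)
  finally show ?thesis .
qed

lemma choose_le_power: "n choose r \<le> n ^ r"
  by (cases "r \<le> n") (auto intro: binomial_le_pow simp: binomial_eq_0)

lemma sum_power_less_one:
  fixes q :: real
  assumes "0 \<le> q" "q < 1/2"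
  shows "(\<Sum>r=1..k. q ^ r) < 1"
proof -
  have "(\<Sum>r=1..k. q ^ r) \<le> 1 - (1/2) ^ k"
  proof (induction k)
    case (Suc k)
    have "q ^ Suc k \<le> (1/2) ^ Suc k" using assms by (intro power_mono) auto
    with Suc show ?case by simp
  qed simp
  also have "\<dots> < 1" by simp
  finally show ?thesis .
qed

text \<open>A set that is not locally sparse contains some \<open>A\<close> of exactly
  \<open>8 * r\<close> entries inside an \<open>r\<close> by \<open>r\<close> rectangle. The union
  bound over \<open>r\<close>, the rectangle and \<open>A\<close> counts fewer than all
  \<open>N\<close>-subsets of the grid.\<close>

lemma ex_locally_sparse:
  assumes N: "N \<le> n * n" and q: "real n ^ 2 * (real k ^ 2 * (real N / real (n * n))) ^ 8 < 1/2"
  shows "\<exists>E \<subseteq> {..<n} \<times> {..<n}. card E = N \<and> locally_sparse n k E"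
proof (rule ccontr)
  assume contr: "\<not> ?thesis"
  let ?U = "{..<n} \<times> {..<n}" 
  define p where "p = real N / real (n * n)"
  \<comment> \<open>This is the price of one unit of \<open>r\<close>: \<open>n ^ 2\<close> for a
    row and a column, and \<open>k ^ 2 * p\<close> for each of 8 entries, which are chosen crudely
    among at most \<open>k ^ 2\<close> places and are each present with density
    \<open>p\<close>.\<close>
  define \<theta> where "\<theta> = real n ^ 2 * (real k ^ 2 * p) ^ 8"
  define b where "b = real (n * n choose N)"
  have p: "0 \<le> p" and \<theta>: "0 \<le> \<theta>" "\<theta> < 1/2" using q unfolding p_def \<theta>_def by simp_all
  have b: "0 < b" using zero_less_binomial[OF N] unfolding b_def by (simp only: of_nat_0_less_iff)
  define V where "V r = {S. S \<subseteq> {..<n} \<and> card S = r}" for r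
  define Sup where "Sup A = {E. E \<subseteq> ?U \<and> card E = N \<and> A \<subseteq> E}" for A
  define Bad where "Bad r = (\<Union>S\<in>V r. \<Union>T\<in>V r. \<Union>A\<in>{A. A \<subseteq> S \<times> T \<and> card A = 8 * r}. Sup A)" for r
  have fU: "finite ?U" by simp
  have cU: "card ?U = n * n" by (simp add: card_cartesian_product)
  have finV: "finite (V r)" and cardV: "card (V r) = n choose r" for r
    by (simp_all add: V_def n_subsets)
  have finSup: "finite (Sup A)" for A
    by (rule finite_subset[of _ "Pow ?U"]) (auto simp: Sup_def)
  have "{E. E \<subseteq> ?U \<and> card E = N} \<subseteq> (\<Union>r\<in>{1..k}. Bad r)"
  proof
    fix E assume E: "E \<in> {E. E \<subseteq> ?U \<and> card E = N}"
    then have "\<not> locally_sparse n k E" using contr by simp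
    then obtain S T where ST: "S \<subseteq> {..<n}" "T \<subseteq> {..<n}" "card S = card T"
      "1 \<le> card S" "card S \<le> k" "8 * card S \<le> card (E \<inter> S \<times> T)"
      unfolding locally_sparse_def by (auto simp: not_less)
    obtain A where A: "A \<subseteq> E \<inter> S \<times> T" "card A = 8 * card S"
      using obtain_subset_with_card_n[OF ST(6)] by metis
    have "S \<in> V (card S)" "T \<in> V (card S)" using ST by (auto simp: V_def)
    moreover have "E \<in> Sup A" "A \<in> {A. A \<subseteq> S \<times> T \<and> card A = 8 * card S}"
      using E A by (auto simp: Sup_def)
    ultimately have "E \<in> Bad (card S)" unfolding Bad_def by blast
    then show "E \<in> (\<Union>r\<in>{1..k}. Bad r)" using ST by auto
  qed
  moreover have "finite (\<Union>r\<in>{1..k}. Bad r)"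
    by (rule finite_subset[of _ "Pow ?U"]) (auto simp: Bad_def Sup_def)
  ultimately have "card {E. E \<subseteq> ?U \<and> card E = N} \<le> card (\<Union>r\<in>{1..k}. Bad r)"
    by (intro card_mono)
  then have "b \<le> real (card (\<Union>r\<in>{1..k}. Bad r))"
    using n_subsets[OF fU, of N] by (simp only: cU b_def of_nat_le_iff)
  also have "\<dots> \<le> (\<Sum>r=1..k. real (card (Bad r)))"
    using card_UN_le[of "{1..k}" Bad] by (simp flip: of_nat_sum)
  also have "\<dots> \<le> (\<Sum>r=1..k. b * \<theta> ^ r)"
  proof (rule sum_mono)
    fix r assume r: "r \<in> {1..k}"
    have 1: "real (card (Sup A)) \<le> b * p ^ (8 * r)"
      if "A \<subseteq> S \<times> T" "card A = 8 * r" "S \<in> V r" "T \<in> V r" for A S T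
    proof -
      have "S \<times> T \<subseteq> ?U" by (rule Sigma_mono) (use that(3,4) in \<open>simp_all add: V_def\<close>)
      with that(1) have A: "A \<subseteq> ?U" by (rule subset_trans)
      have N': "N \<le> card ?U" unfolding cU by (rule N)
      show ?thesis
        using card_supersets_le[OF fU A N'] unfolding Sup_def b_def p_def cU that(2) .
    qed
    have 2: "real (card (\<Union>A\<in>{A. A \<subseteq> S \<times> T \<and> card A = 8 * r}. Sup A))
        \<le> (real k ^ 2) ^ (8 * r) * (b * p ^ (8 * r))" if ST: "S \<in> V r" "T \<in> V r" for S T
    proof -
      have fin: "finite (S \<times> T)"
        using ST finite_subset[of _ "{..<n}"] by (simp add: V_def)
      have "card {A. A \<subseteq> S \<times> T \<and> card A = 8 * r} = r * r choose (8 * r)"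
        using ST fin by (simp add: n_subsets card_cartesian_product V_def)
      also have "\<dots> \<le> (r * r) ^ (8 * r)" by (rule choose_le_power)
      also have "\<dots> \<le> (k ^ 2) ^ (8 * r)"
        using r by (intro power_mono) (auto simp: power2_eq_square mult_mono)
      finally have "real (card {A. A \<subseteq> S \<times> T \<and> card A = 8 * r}) \<le> real ((k ^ 2) ^ (8 * r))"
        by (rule of_nat_mono)
      then have c: "real (card {A. A \<subseteq> S \<times> T \<and> card A = 8 * r}) \<le> (real k ^ 2) ^ (8 * r)"
        by (simp only: of_nat_power)
      have "real (card (\<Union>A\<in>{A. A \<subseteq> S \<times> T \<and> card A = 8 * r}. Sup A))
          \<le> real (card {A. A \<subseteq> S \<times> T \<and> card A = 8 * r}) * (b * p ^ (8 * r))"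
      proof (rule card_UN_le_mult)
        show "finite {A. A \<subseteq> S \<times> T \<and> card A = 8 * r}"
          by (rule finite_subset[of _ "Pow (S \<times> T)"]) (use fin in auto)
        show "real (card (Sup A)) \<le> b * p ^ (8 * r)" if "A \<in> {A. A \<subseteq> S \<times> T \<and> card A = 8 * r}" for A
          by (rule 1[OF _ _ ST]) (use that in simp_all)
      qed
      also have "\<dots> \<le> (real k ^ 2) ^ (8 * r) * (b * p ^ (8 * r))"
        using p b by (intro mult_right_mono c) auto
      finally show ?thesis .
    qed
    have 3: "real (card (\<Union>T\<in>V r. \<Union>A\<in>{A. A \<subseteq> S \<times> T \<and> card A = 8 * r}. Sup A))
        \<le> real (n choose r) * ((real k ^ 2) ^ (8 * r) * (b * p ^ (8 * r)))" if "S \<in> V r" for S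
      by (rule card_UN_le_mult[OF finV, unfolded cardV]) (rule 2[OF that])
    have "real (card (Bad r))
        \<le> real (n choose r) * (real (n choose r) * ((real k ^ 2) ^ (8 * r) * (b * p ^ (8 * r))))"
      unfolding Bad_def by (rule card_UN_le_mult[OF finV, unfolded cardV]) (rule 3)
    also have "\<dots> \<le> real n ^ r * (real n ^ r * ((real k ^ 2) ^ (8 * r) * (b * p ^ (8 * r))))"
    proof -
      have "real (n choose r) \<le> real n ^ r"
        using of_nat_mono[OF choose_le_power[of n r]] by (simp only: of_nat_power)
      then show ?thesis using p b by (intro mult_mono mult_nonneg_nonneg) simp_all
    qed
    also have "\<dots> = b * \<theta> ^ r"
      unfolding \<theta>_def by (simp only: power_mult_distrib power2_eq_square mult_ac flip: power_mult)
    finally show "real (card (Bad r)) \<le> b * \<theta> ^ r" .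
  qed
  also have "\<dots> = b * (\<Sum>r=1..k. \<theta> ^ r)" by (simp add: sum_distrib_left)
  also have "\<dots> < b * 1"
  proof (rule mult_strict_left_mono)
    show "(\<Sum>r=1..k. \<theta> ^ r) < 1" using \<theta> by (rule sum_power_less_one)
  qed (rule b)
  finally show False by simp
qed

section \<open>Small submatrices of a locally sparse matrix\<close>

text \<open>Peeling off one light row or column at a time leaves each entry charged either to its row
  or to its column.\<close>

lemma ex_light_decomposition:
  fixes E :: "('a \<times> 'b) set"
  assumes "finite S" "finite T"
    and "\<And>S' T'. S' \<subseteq> S \<Longrightarrow> T' \<subseteq> T \<Longrightarrow> S' \<noteq> {} \<Longrightarrow> T' \<noteq> {} \<Longrightarrow>
      (\<exists>x\<in>S'. card {y \<in> T'. (x, y) \<in> E} \<le> d) \<or> (\<exists>y\<in>T'. card {x \<in> S'. (x, y) \<in> E} \<le> d)"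
  shows "\<exists>a b. (\<forall>x. a x \<subseteq> T \<and> card (a x) \<le> d) \<and> (\<forall>y. b y \<subseteq> S \<and> card (b y) \<le> d) \<and>
     (\<forall>x\<in>S. \<forall>y\<in>T. (x, y) \<in> E \<longleftrightarrow> y \<in> a x \<or> x \<in> b y)"
proof -
  define light where "light S' T' \<longleftrightarrow> (\<exists>x\<in>S'. card {y \<in> T'. (x, y) \<in> E} \<le> d) \<or>
      (\<exists>y\<in>T'. card {x \<in> S'. (x, y) \<in> E} \<le> d)" for S' T'
  have "\<forall>S'\<subseteq>S. \<forall>T'\<subseteq>T. S' \<noteq> {} \<longrightarrow> T' \<noteq> {} \<longrightarrow> light S' T'"
    using assms(3) unfolding light_def by simp
  with assms(1,2) show ?thesis
  proof (induction "card S + card T" arbitrary: S T rule: less_induct)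
    case less
    show ?case
    proof (cases "S = {} \<or> T = {}")
      case True
      then show ?thesis by (intro exI[of _ "\<lambda>_. {}"]) auto
    next
      case False
      then have "light S T" using less.prems(3) by simp
      then consider (row) x where "x \<in> S" "card {y \<in> T. (x, y) \<in> E} \<le> d"
        | (col) y where "y \<in> T" "card {x \<in> S. (x, y) \<in> E} \<le> d"
        unfolding light_def by blast
      then show ?thesis
      proof cases
        case row
        have lt: "card (S - {x}) + card T < card S + card T"
          using card_Diff1_less[OF less.prems(1) row(1)] by simp
        have "\<forall>S'\<subseteq>S - {x}. \<forall>T'\<subseteq>T. S' \<noteq> {} \<longrightarrow> T' \<noteq> {} \<longrightarrow> light S' T'"
          using less.prems(3) by blast
        from less.hyps[OF lt finite_Diff[OF less.prems(1)] less.prems(2) this]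
        obtain a b where ab: "\<forall>z. a z \<subseteq> T \<and> card (a z) \<le> d"
          "\<forall>y. b y \<subseteq> S - {x} \<and> card (b y) \<le> d"
          "\<forall>z\<in>S - {x}. \<forall>y\<in>T. (z, y) \<in> E \<longleftrightarrow> y \<in> a z \<or> z \<in> b y"
          by (elim exE conjE)
        \<comment> \<open>No \<open>b y\<close> contains \<open>x\<close>, so row \<open>x\<close>
          is decided by the new value of \<open>a\<close> at \<open>x\<close> alone, and the other
          rows keep their charges.\<close>
        show ?thesis
          by (intro exI[of _ "a(x := {y \<in> T. (x, y) \<in> E})"] exI[of _ b])
             (use ab row in \<open>auto simp: subset_iff\<close>)
      next
        case col
        have lt: "card S + card (T - {y}) < card S + card T"
          using card_Diff1_less[OF less.prems(2) col(1)] by simp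
        have "\<forall>S'\<subseteq>S. \<forall>T'\<subseteq>T - {y}. S' \<noteq> {} \<longrightarrow> T' \<noteq> {} \<longrightarrow> light S' T'"
          using less.prems(3) by blast
        from less.hyps[OF lt less.prems(1) finite_Diff[OF less.prems(2)] this]
        obtain a b where ab: "\<forall>x. a x \<subseteq> T - {y} \<and> card (a x) \<le> d"
          "\<forall>z. b z \<subseteq> S \<and> card (b z) \<le> d"
          "\<forall>x\<in>S. \<forall>z\<in>T - {y}. (x, z) \<in> E \<longleftrightarrow> z \<in> a x \<or> x \<in> b z"
          by (elim exE conjE)
        show ?thesis
          by (intro exI[of _ a] exI[of _ "b(y := {x \<in> S. (x, y) \<in> E})"])
             (use ab col in \<open>auto simp: subset_iff\<close>)
      qed
    qed
  qed
qed

lemma card_Int_Times_ge: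
  assumes "finite S" "finite T" "\<And>x. x \<in> S \<Longrightarrow> d \<le> card {y \<in> T. (x, y) \<in> E}"
  shows "d * card S \<le> card (E \<inter> S \<times> T)"
proof -
  have "d * card S \<le> (\<Sum>x\<in>S. card {y \<in> T. (x, y) \<in> E})"
    using sum_bounded_below[of S d] assms(3) by (simp add: mult.commute)
  also have "\<dots> = card (SIGMA x:S. {y \<in> T. (x, y) \<in> E})"
    using assms by simp
  also have "(SIGMA x:S. {y \<in> T. (x, y) \<in> E}) = E \<inter> S \<times> T" by auto
  finally show ?thesis .
qed

text \<open>Transposing reduces the search for a light column to that for a light row.\<close>

lemma locally_sparse_converse:
  assumes "locally_sparse n k E"
  shows "locally_sparse n k (E\<inverse>)"
  unfolding locally_sparse_def
proof (intro allI impI)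
  fix S T assume *: "S \<subseteq> {..<n}" "T \<subseteq> {..<n}" "card S = card T" "1 \<le> card S" "card S \<le> k"
  have "E\<inverse> \<inter> S \<times> T = (E \<inter> T \<times> S)\<inverse>" by auto
  then have "card (E\<inverse> \<inter> S \<times> T) = card (E \<inter> T \<times> S)" by (simp only: card_inverse)
  also have "\<dots> < 8 * card T" by (rule locally_sparseD[OF assms]) (use * in simp_all)
  finally show "card (E\<inverse> \<inter> S \<times> T) < 8 * card S" using * by simp
qed

text \<open>If every row had 8 ones in \<open>T\<close>, then \<open>S \<times> T\<close> would hold
  at least \<open>8 * card S\<close> ones. Enlarging \<open>T\<close> to \<open>card S\<close>
  columns gives a square that contradicts local sparsity.\<close>

lemma ex_light_row:
  assumes E: "locally_sparse n k E"
    and S: "S \<subseteq> {..<n}" "S \<noteq> {}" "card S \<le> k"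
    and T: "T \<subseteq> {..<n}" "card T \<le> card S"
  shows "\<exists>x\<in>S. card {y \<in> T. (x, y) \<in> E} \<le> 7"
proof (rule ccontr)
  assume "\<not> ?thesis"
  then have ge: "8 \<le> card {y \<in> T. (x, y) \<in> E}" if "x \<in> S" for x
    using that by force
  have fin: "finite S" "finite T"
    using finite_subset[OF S(1)] finite_subset[OF T(1)] by simp_all
  have "card S \<le> card {..<n}" using S by (intro card_mono) auto
  then obtain T' where T': "T \<subseteq> T'" "T' \<subseteq> {..<n}" "card T' = card S"
    using exists_subset_between[of T "card S" "{..<n}"] T by auto
  have "8 * card S \<le> card (E \<inter> S \<times> T)" using fin ge by (rule card_Int_Times_ge)
  also have "\<dots> \<le> card (E \<inter> S \<times> T')"
    using T' fin(1) finite_subset[OF T'(2)] by (intro card_mono) auto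
  also have "\<dots> < 8 * card S"
    by (rule locally_sparseD[OF E]) (use S T' fin in \<open>simp_all add: Suc_le_eq card_gt_0_iff\<close>)
  finally show False by simp
qed

text \<open>Every subrectangle has a light line: a row if it has at least as many rows as columns,
  otherwise a column. Peeling then applies, and the hash protocol works on the original indices,
  recovered by \<open>pick\<close>.\<close>

lemma R_submatrix_le_14:
  assumes E: "locally_sparse n k E"
    and I: "I \<subseteq> {..<n}" "card I \<le> k"
    and J: "J \<subseteq> {..<n}" "card J \<le> k"
  shows "R (submatrix (mat_of_ones n E) I J) \<le> 14"
proof -
  have fin: "finite I" "finite J"
    using finite_subset[OF I(1)] finite_subset[OF J(1)] by simp_all
  have "\<exists>a b. (\<forall>x. a x \<subseteq> J \<and> card (a x) \<le> 7) \<and> (\<forall>y. b y \<subseteq> I \<and> card (b y) \<le> 7) \<and>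
     (\<forall>x\<in>I. \<forall>y\<in>J. (x, y) \<in> E \<longleftrightarrow> y \<in> a x \<or> x \<in> b y)"
  proof (rule ex_light_decomposition[OF fin])
    fix S T assume ST: "S \<subseteq> I" "T \<subseteq> J" "S \<noteq> {}" "T \<noteq> {}"
    have "card S \<le> k" "card T \<le> k" 
      using card_mono[OF fin(1) ST(1)] card_mono[OF fin(2) ST(2)] I J by simp_all
    show "(\<exists>x\<in>S. card {y \<in> T. (x, y) \<in> E} \<le> 7) \<or> (\<exists>y\<in>T. card {x \<in> S. (x, y) \<in> E} \<le> 7)"
    proof (cases "card T \<le> card S")
      case True
      then show ?thesis
        using ex_light_row[OF E, of S T] ST subset_trans[OF ST(1) I(1)] subset_trans[OF ST(2) J(1)]
          \<open>card S \<le> k\<close> by simp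
    next
      case False
      then show ?thesis
        using ex_light_row[OF locally_sparse_converse[OF E], of T S] ST
          subset_trans[OF ST(1) I(1)] subset_trans[OF ST(2) J(1)] \<open>card T \<le> k\<close> by simp
    qed
  qed
  then obtain a b where ab: "\<And>x. a x \<subseteq> J \<and> card (a x) \<le> 7" "\<And>y. b y \<subseteq> I \<and> card (b y) \<le> 7"
    "\<And>x y. x \<in> I \<Longrightarrow> y \<in> J \<Longrightarrow> (x, y) \<in> E \<longleftrightarrow> y \<in> a x \<or> x \<in> b y"
    by blast
  let ?F = "submatrix (mat_of_ones n E) I J"
  have II: "{i. i < n \<and> i \<in> I} = I" "{j. j < n \<and> j \<in> J} = J" using I J by auto
  have dim: "dim_row ?F = card I" "dim_col ?F = card J"
    by (simp_all add: dim_submatrix mat_of_ones_def II)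
  have pI: "pick I i \<in> I" if "i < card I" for i using that fin(1) by (simp add: pick_in_set_le)
  have pJ: "pick J j \<in> J" if "j < card J" for j using that fin(2) by (simp add: pick_in_set_le)
  show ?thesis
  proof (rule R_le_14[where \<rho> = "pick I" and \<sigma> = "pick J" and a = a and b = b and n = n])
    fix i j assume "i < dim_row ?F" "j < dim_col ?F"
    then have ij: "i < card I" "j < card J" by (simp_all add: dim)
    have "?F $$ (i, j) = mat_of_ones n E $$ (pick I i, pick J j)"
      by (rule submatrix_index) (use ij in \<open>simp_all add: mat_of_ones_def II\<close>)
    also have "\<dots> \<longleftrightarrow> (pick I i, pick J j) \<in> E"
      unfolding mat_of_ones_def
      by (subst index_mat) (use pI[OF ij(1)] pJ[OF ij(2)] I J in auto)
    also have "\<dots> \<longleftrightarrow> pick J j \<in> a (pick I i) \<or> pick I i \<in> b (pick J j)"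
      using pI[OF ij(1)] pJ[OF ij(2)] by (rule ab(3))
    finally show "?F $$ (i, j) \<longleftrightarrow> pick J j \<in> a (pick I i) \<or> pick I i \<in> b (pick J j)" .
  qed (use pI pJ dim ab I J in \<open>auto simp: subset_iff\<close>)
qed

section \<open>Hitting the prescribed cost, and the choice of parameters\<close>

lemma ex_R_eq:
  assumes s: "real (n * n) < (9/8) ^ s" and N: "N = Suc ((n + 2) * 2 ^ w * (2 * s))" "N \<le> n * n"
    and q: "real n ^ 2 * (real k ^ 2 * (real N / real (n * n))) ^ 8 < 1/2"
    and w: "2 \<le> w"
  shows "\<exists>E. R (mat_of_ones n E) = w \<and> locally_sparse n k E"
proof -
  obtain E0 where E0: "E0 \<subseteq> {..<n} \<times> {..<n}" "card E0 = N" "locally_sparse n k E0"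
    using ex_locally_sparse[OF N(2) q] by blast
  let ?L = "{E \<in> Pow ({..<n} \<times> {..<n}). R (mat_of_ones n E) \<le> w}"
  have fin: "finite E0" using E0 by (auto intro: finite_subset)
  \<comment> \<open>The \<open>Suc\<close> in \<open>N\<close> makes the subsets of
    \<open>E0\<close> outnumber all sets of cost at most \<open>w\<close>.\<close>
  have "\<not> Pow E0 \<subseteq> ?L"
  proof
    assume "Pow E0 \<subseteq> ?L"
    then have "card (Pow E0) \<le> card ?L" by (intro card_mono) auto
    also have "\<dots> \<le> 2 ^ ((n + 2) * 2 ^ w * (2 * s))" by (rule card_low_cost[OF s])
    also have "\<dots> < 2 ^ N" using N(1) by simp
    finally show False using E0 fin by (simp add: card_Pow)
  qed
  then obtain E where "E \<in> Pow E0" "E \<notin> ?L" by blast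
  then have E: "E \<subseteq> E0" "w < R (mat_of_ones n E)" using E0(1) by auto
  \<comment> \<open>\<open>M r\<close> keeps the first \<open>r\<close> rows of \<open>E\<close>, so
    consecutive matrices differ in one row only.\<close>
  define M where "M r = mat_of_ones n (E \<inter> {..<r} \<times> UNIV)" for r
  have M0: "R (M 0) = 0" by (rule R_zero) (simp add: M_def mat_of_ones_def)
  have "E \<inter> {..<n} \<times> UNIV = E" using E E0 by auto
  then have Mn: "w \<le> R (M n)" using E by (simp add: M_def)
  have step: "R (M (Suc r)) \<le> Suc (max (R (M r)) 1)" for r
    by (rule R_change_row[where r = r]) (auto simp: M_def mat_of_ones_def)
  define r where "r = (LEAST r. w \<le> R (M r))"
  have r: "w \<le> R (M r)" unfolding r_def by (rule LeastI[of "\<lambda>r. w \<le> R (M r)", OF Mn])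
  with M0 w obtain r' where r': "r = Suc r'" by (cases r) auto
  then have "R (M r') < w"
    using not_less_Least[of r' "\<lambda>r. w \<le> R (M r)"] unfolding r_def by (simp add: not_le)
  \<comment> \<open>From cost 0 a step may jump to 2; as \<open>2 \<le> w\<close>, even such a jump
    does not pass \<open>w\<close>.\<close>
  then have "R (M r) \<le> w" using step[of r'] w r' by auto
  with r have "R (M r) = w" by simp
  moreover have "locally_sparse n k (E \<inter> {..<r} \<times> UNIV)"
    by (rule locally_sparse_subset[OF E0(3)]) (use E(1) in auto)
  ultimately show ?thesis unfolding M_def by blast
qed

text \<open>All requirements compare powers of \<open>n\<close>: \<open>s\<close> is of order
  \<open>ln n\<close> and \<open>2 ^ w n\<close> is at most \<open>n powr (1/1000)\<close>, so
  \<open>N\<close> eventually stays below \<open>n powr (101/100)\<close>.\<close>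

lemma eventually_parameters:
  fixes w :: "nat \<Rightarrow> nat"
  assumes w: "\<forall>n\<ge>1. real (w n) \<le> 1 / 10 ^ 3 * log 2 (real n)"
  shows "\<forall>\<^sub>F n in sequentially. \<exists>s N. real (n * n) < (9/8) ^ s \<and>
     N = Suc ((n + 2) * 2 ^ w n * (2 * s)) \<and> N \<le> n * n \<and>
     real n ^ 2 * (real (nat \<lfloor>real n powr (1/4)\<rfloor>) ^ 2 * (real N / real (n * n))) ^ 8 < 1/2"
proof -
  have "\<forall>\<^sub>F n in sequentially.
      (real n + 2) * real n powr (1/1000) * (2 * (20 * ln (real n) + 1)) + 1 \<le> real n powr (101/100)"
    by real_asymp
  \<comment> \<open>The exponent of \<open>n\<close> is 2 + 8 * (1/2 + 1.01 - 2) = -1.92, so the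
    left side tends to 0.\<close>
  moreover have "\<forall>\<^sub>F n in sequentially.
      real n ^ 2 * (real n powr (1/2) * (real n powr (101/100) / real n ^ 2)) ^ 8 < 1/2"
    by real_asymp
  moreover have "\<forall>\<^sub>F n in sequentially. real n powr (101/100) \<le> real n ^ 2"
    by real_asymp
  moreover have "\<forall>\<^sub>F n in sequentially. (2::nat) \<le> n"
    by (rule eventually_ge_at_top)
  ultimately show ?thesis
  proof eventually_elim
    case (elim n)
    \<comment> \<open>The factor 20 suffices because \<open>ln (9/8)\<close> is at least 1/9 and
      20/9 > 2.\<close>
    define s where "s = nat \<lceil>20 * ln (real n)\<rceil>"
    define N where "N = Suc ((n + 2) * 2 ^ w n * (2 * s))"
    define k where "k = nat \<lfloor>real n powr (1/4)\<rfloor>"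
    have ln: "ln (real n) > 0" using elim by simp
    have s: "20 * ln (real n) \<le> real s" "real s \<le> 20 * ln (real n) + 1"
      unfolding s_def using ln by linarith+
    have "ln (real (n * n)) = 2 * ln (real n)" using elim by (simp add: ln_mult)
    also have "\<dots> < real s * (1/9)" using s(1) ln by simp
    \<comment> \<open>From \<open>ln x \<le> x - 1\<close> at 8/9, as
      \<open>ln (9/8) = - ln (8/9)\<close>.\<close>
    also have "\<dots> \<le> real s * ln (9/8)"
      using ln_le_minus_one[of "8/9 :: real"] ln_div[of 8 "9::real"] ln_div[of 9 "8::real"]
      by (intro mult_left_mono) auto
    also have "\<dots> = ln ((9/8) ^ s)" by (simp add: ln_realpow)
    finally have 1: "real (n * n) < (9/8) ^ s"
      using elim by (subst (asm) ln_less_cancel_iff) auto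
    have "2 ^ w n = 2 powr real (w n)" by (simp add: powr_realpow)
    also have "\<dots> \<le> 2 powr (1 / 1000 * log 2 (real n))"
      using w[rule_format, of n] elim by (intro powr_mono) auto
    also have "\<dots> = (2 powr log 2 (real n)) powr (1/1000)"
      by (simp add: powr_powr mult.commute)
    also have "\<dots> = real n powr (1/1000)" using elim by (simp add: powr_log_cancel)
    finally have w': "2 ^ w n \<le> real n powr (1/1000)" .
    have "real N = (real n + 2) * 2 ^ w n * (2 * real s) + 1"
      by (simp add: N_def algebra_simps)
    also have "\<dots> \<le> (real n + 2) * real n powr (1/1000) * (2 * (20 * ln (real n) + 1)) + 1"
      using w' s ln by (intro add_mono mult_mono) auto
    also note elim(1)
    finally have N: "real N \<le> real n powr (101/100)" .
    then have "real N \<le> real (n * n)" using elim(3) by (simp add: power2_eq_square)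
    then have 2: "N \<le> n * n" by (simp only: of_nat_le_iff)
    have "real k \<le> real n powr (1/4)" unfolding k_def by simp
    then have "real k ^ 2 \<le> (real n powr (1/4)) ^ 2" by (intro power_mono) auto
    also have "\<dots> = real n powr (1/2)" by (simp add: power2_eq_square flip: powr_add)
    finally have k: "real k ^ 2 \<le> real n powr (1/2)" .
    have "real n ^ 2 * (real k ^ 2 * (real N / real (n * n))) ^ 8
        \<le> real n ^ 2 * (real n powr (1/2) * (real n powr (101/100) / real n ^ 2)) ^ 8"
      unfolding power2_eq_square[of "real n"] of_nat_mult[symmetric]
      using k N by (intro mult_left_mono power_mono mult_mono divide_right_mono) auto
    also note elim(2)
    finally show ?case using 1 2 N_def unfolding k_def by blast
  qed
qed

theorem theorem3p1:
  shows "\<exists>C::nat. \<forall>w :: nat \<Rightarrow> nat.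
    mono w \<longrightarrow> filterlim w at_top at_top \<longrightarrow>
    (\<forall>n\<ge>1. real (w n) \<le> 1 / 10 ^ 3 * log 2 (real n)) \<longrightarrow>
    (\<exists>N::nat. \<forall>n\<ge>N. \<exists>M :: bool mat. M \<in> carrier_mat n n \<and>
       R M = w n \<and>
       (\<forall>I J. I \<subseteq> {..<n} \<longrightarrow> J \<subseteq> {..<n} \<longrightarrow>
          card I = nat \<lfloor>real n powr (1/4)\<rfloor> \<longrightarrow>
          card J = nat \<lfloor>real n powr (1/4)\<rfloor> \<longrightarrow>
          R (submatrix M I J) \<le> C))"
\<comment> \<open>The constant is the cost of the hash protocol, which depends neither on
  \<open>w\<close> nor on \<open>n\<close>.\<close>
proof (rule exI[of _ 14], intro allI impI)
  fix w :: "nat \<Rightarrow> nat"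
  assume "mono w" and lim: "filterlim w at_top at_top"
    and w: "\<forall>n\<ge>1. real (w n) \<le> 1 / 10 ^ 3 * log 2 (real n)"
  let ?k = "\<lambda>n. nat \<lfloor>real n powr (1/4)\<rfloor>"
  \<comment> \<open>Divergence of \<open>w\<close> supplies the lower bound 2 that the row-by-row
    argument needs.\<close>
  have "\<forall>\<^sub>F n in sequentially. 2 \<le> w n"
    using lim by (simp add: filterlim_at_top)
  with eventually_parameters[OF w]
  have "\<forall>\<^sub>F n in sequentially. \<exists>E. R (mat_of_ones n E) = w n \<and> locally_sparse n (?k n) E"
    by eventually_elim (blast intro: ex_R_eq)
  then obtain N where N: "\<And>n. n \<ge> N \<Longrightarrow> \<exists>E. R (mat_of_ones n E) = w n \<and> locally_sparse n (?k n) E"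
    unfolding eventually_sequentially by blast
  show "\<exists>N. \<forall>n\<ge>N. \<exists>M :: bool mat. M \<in> carrier_mat n n \<and> R M = w n \<and>
      (\<forall>I J. I \<subseteq> {..<n} \<longrightarrow> J \<subseteq> {..<n} \<longrightarrow> card I = ?k n \<longrightarrow> card J = ?k n \<longrightarrow>
        R (submatrix M I J) \<le> 14)"
  proof (intro exI[of _ N] allI impI)
    fix n assume "N \<le> n"
    then obtain E where E: "R (mat_of_ones n E) = w n" "locally_sparse n (?k n) E"
      using N by blast
    show "\<exists>M :: bool mat. M \<in> carrier_mat n n \<and> R M = w n \<and>
        (\<forall>I J. I \<subseteq> {..<n} \<longrightarrow> J \<subseteq> {..<n} \<longrightarrow> card I = ?k n \<longrightarrow> card J = ?k n \<longrightarrow>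
          R (submatrix M I J) \<le> 14)"
    proof (intro exI[of _ "mat_of_ones n E"] conjI allI impI)
      show "mat_of_ones n E \<in> carrier_mat n n" by (simp add: mat_of_ones_def)
    qed (use E in \<open>auto intro: R_submatrix_le_14\<close>)
  qed
qed

end
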